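(* Let $n \ge 1$ and $m \ge 1$ be integers, let $S_1, \ldots, S_m \subseteq \mathbb{Z}^n$ be integrally convex sets, and let $W = S_1 + \cdots + S_m$. Put $\beta(n,m) = \frac{1}{2}\sqrt{n \cdot \min(n,m)}$. Then for every $x \in \overline{W}$ there exists $z \in W$ with $\|x - z\|_2 \le \beta(n,m)$ (and hence $\|x - z\|_\infty \le \beta(n,m)$). If moreover $x \in \overline{W} \cap \mathbb{Z}^n$, then $z$ can be chosen with $\|x - z\|_\infty \le \lfloor \beta(n,m) \rfloor$.
   Context: For $S \subseteq \mathbb{R}^n$, $\overline{S}$ denotes the convex hull of $S$. The Minkowski sum is $S_1 + \cdots + S_m = \{x^1 + \cdots + x^m \mid x^i \in S_i\}$. For $x \in \mathbb{R}^n$, the integral neighborhood is $\mathrm{N}(x) = \{z \in \mathbb{Z}^n \mid |x_i - z_i| < 1 \ (i = 1, \ldots, n)\}$. A nonempty set $S \subseteq \mathbb{Z}^n$ is integrally convex if every $x \in \overline{S}$ satisfies $x \in \overline{S \cap \mathrm{N}(x)}$. *)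

theory Defs
  imports "HOL-Analysis.Analysis"
begin

definition integer_points :: "(real ^ 'n) set"
  where "integer_points = {z. \<forall>i. z $ i \<in> \<int>}"

definition integral_neighborhood :: "real ^ 'n \<Rightarrow> (real ^ 'n) set"
  where "integral_neighborhood x = {z \<in> integer_points. \<forall>i. \<bar>x $ i - z $ i\<bar> < 1}"

definition integrally_convex :: "(real ^ 'n) set \<Rightarrow> bool"
  where "integrally_convex S \<longleftrightarrow>
    S \<noteq> {} \<and> S \<subseteq> integer_points \<and>
    (\<forall>x \<in> convex hull S. x \<in> convex hull (S \<inter> integral_neighborhood x))"

definition sf_bound :: "nat \<Rightarrow> nat \<Rightarrow> real"
  where "sf_bound n m = 1 / 2 * sqrt (real (n * min n m))"

end

theory Submission
  imports Defs
begin

text \<open>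
  This is the Shapley--Folkman--Starr argument. A point of the convex hull of \<open>W\<close> is a sum of
  points \<open>x i\<close> in the convex hulls of the \<open>S i\<close>, and integral convexity replaces \<open>S i\<close> by its part
  \<open>T i\<close> in the integral neighborhood of \<open>x i\<close>, which lies in a unit cube and hence in a ball of
  radius \<open>sqrt n / 2\<close>. By the Shapley--Folkman lemma all but \<open>min n m\<close> of the summands may be taken
  in \<open>T i\<close> itself, and rounding the others one after another into \<open>T i\<close> increases the squared error
  by at most \<open>n / 4\<close> each time.
\<close>

section \<open>The Shapley--Folkman lemma\<close>

text \<open>Dependence is needed for an indexed family, while \<open>dependent\<close> speaks of
  sets and does not see repeated vectors. If \<open>d\<close> is injective on \<open>J\<close>, the
  set version transfers; otherwise a repeated value \<open>d i = d j\<close> gives the coefficients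
  1 and -1.\<close>

lemma linear_dependence_family:
  fixes d :: "'i \<Rightarrow> 'a::euclidean_space"
  assumes "finite J" and card: "card J > DIM('a)"
  obtains \<mu> where "(\<Sum>i\<in>J. \<mu> i *\<^sub>R d i) = 0" and "\<exists>i\<in>J. \<mu> i \<noteq> 0"
proof (cases "inj_on d J")
  case True
  then have "card (d ` J) > DIM('a)"
    by (simp add: card card_image)
  then have "dependent (d ` J)"
    by (intro dependent_biggerset) (use \<open>finite J\<close> in auto)
  then obtain u where u: "\<exists>v\<in>d ` J. u v \<noteq> 0" "(\<Sum>v\<in>d ` J. u v *\<^sub>R v) = 0"
    using \<open>finite J\<close> by (auto simp: dependent_finite)
  show thesis
  proof
    show "(\<Sum>i\<in>J. u (d i) *\<^sub>R d i) = 0"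
      using u(2) True by (simp add: sum.reindex)
    show "\<exists>i\<in>J. u (d i) \<noteq> 0"
      using u(1) by blast
  qed
next
  case False
  then obtain i j where ij: "i \<in> J" "j \<in> J" "i \<noteq> j" "d i = d j"
    by (auto simp: inj_on_def)
  define \<mu> where "\<mu> k = (if k = i then 1 else 0) - (if k = j then 1 else (0::real))" for k
  show thesis
  proof
    have "(\<Sum>k\<in>J. \<mu> k *\<^sub>R d k)
        = (\<Sum>k\<in>J. (if k = i then d k else 0) - (if k = j then d k else 0))"
      by (rule sum.cong) (auto simp: \<mu>_def)
    also have "\<dots> = 0"
      using ij \<open>finite J\<close> by (simp add: sum_subtractf)
    finally show "(\<Sum>k\<in>J. \<mu> k *\<^sub>R d k) = 0" .
    show "\<exists>k\<in>J. \<mu> k \<noteq> 0"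
      using ij by (intro bexI[of _ i]) (auto simp: \<mu>_def)
  qed
qed

text \<open>
  Induction on the total support of the convex combinations: if more than \<open>DIM('a)\<close> of them have two
  support points \<open>a i \<noteq> b i\<close>, a linear dependence among the \<open>a i - b i\<close> allows weight to be
  shifted between \<open>a i\<close> and \<open>b i\<close> until some weight vanishes.
\<close>

lemma shapley_folkman_weights:
  fixes F :: "'i \<Rightarrow> 'a::euclidean_space set" and u :: "'i \<Rightarrow> 'a \<Rightarrow> real"
  assumes "finite I"
    and "\<And>i. i \<in> I \<Longrightarrow> finite (F i)"
    and "\<And>i t. i \<in> I \<Longrightarrow> t \<in> F i \<Longrightarrow> u i t \<ge> 0"
    and "\<And>i. i \<in> I \<Longrightarrow> sum (u i) (F i) = 1"
  shows "\<exists>z. (\<forall>i\<in>I. z i \<in> convex hull F i)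
      \<and> sum z I = (\<Sum>i\<in>I. \<Sum>t\<in>F i. u i t *\<^sub>R t) \<and> card {i\<in>I. z i \<notin> F i} \<le> DIM('a)"
  using assms(2-)
proof (induction "\<Sum>i\<in>I. card (F i)" arbitrary: F u rule: less_induct)
  case less
  note fin = less.prems(1) and nonneg = less.prems(2) and sum1 = less.prems(3)
  define J where "J = {i\<in>I. card (F i) \<ge> 2}"
  have "finite J" "J \<subseteq> I"
    using \<open>finite I\<close> by (auto simp: J_def)
  show ?case
  proof (cases "card J \<le> DIM('a)")
    case True
    define z where "z i = (\<Sum>t\<in>F i. u i t *\<^sub>R t)" for i
    \<comment> \<open>The weights on \<open>F i\<close> sum to 1, so \<open>F i\<close> is nonempty.
      Outside \<open>J\<close> it is therefore a singleton, whose barycentre is its only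
      point.\<close>
    have z: "z i \<in> F i" if "i \<in> I - J" for i
    proof -
      have "card (F i) \<noteq> 0"
        using sum1[of i] fin[of i] that by auto
      then have "card (F i) = 1"
        using that by (auto simp: J_def)
      then obtain t where "F i = {t}"
        by (auto simp: card_1_singleton_iff)
      then show ?thesis
        using sum1[of i] that by (simp add: z_def)
    qed
    then have "{i\<in>I. z i \<notin> F i} \<subseteq> J"
      by blast
    then have "card {i\<in>I. z i \<notin> F i} \<le> DIM('a)"
      by (rule order_trans[OF card_mono[OF \<open>finite J\<close>] True])
    moreover have "z i \<in> convex hull F i" if "i \<in> I" for i
      unfolding z_def
      by (rule convex_sum[OF fin[OF that] convex_convex_hull sum1[OF that] nonneg[OF that]])
        (auto intro: hull_inc)
    moreover have "sum z I = (\<Sum>i\<in>I. \<Sum>t\<in>F i. u i t *\<^sub>R t)"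
      by (simp add: z_def)
    ultimately show ?thesis
      by blast
  next
    case False
    have "\<exists>a b. a \<in> F i \<and> b \<in> F i \<and> a \<noteq> b" if "i \<in> J" for i
      using that fin[of i] card_le_Suc0_iff_eq[of "F i"] by (fastforce simp: J_def)
    then obtain a b where ab: "\<And>i. i \<in> J \<Longrightarrow> a i \<in> F i \<and> b i \<in> F i \<and> a i \<noteq> b i"
      by metis
    obtain \<mu> where \<mu>: "(\<Sum>i\<in>J. \<mu> i *\<^sub>R (a i - b i)) = 0" "\<exists>i\<in>J. \<mu> i \<noteq> 0"
      using linear_dependence_family[OF \<open>finite J\<close>, where d = "\<lambda>i. a i - b i"] False by auto
    \<comment> \<open>The direction of the weight shift: \<open>+ \<mu> i\<close> at
      \<open>a i\<close> and \<open>- \<mu> i\<close> at \<open>b i\<close>. It preserves each total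
      weight, and the linear dependence makes it preserve the sum of all barycentres.\<close>
    define w where "w i t = (if i \<in> J then (if t = a i then \<mu> i else 0) - (if t = b i then \<mu> i else 0)
      else 0)" for i t
    have w_sum: "sum (w i) (F i) = 0" if "i \<in> I" for i
      using that fin ab[of i] by (cases "i \<in> J") (simp_all add: w_def sum_subtractf)
    have "(\<Sum>t\<in>F i. w i t *\<^sub>R t) = (if i \<in> J then \<mu> i *\<^sub>R (a i - b i) else 0)" if "i \<in> I" for i
    proof (cases "i \<in> J")
      case True
      have "(\<Sum>t\<in>F i. w i t *\<^sub>R t)
          = (\<Sum>t\<in>F i. (if t = a i then \<mu> i *\<^sub>R t else 0) - (if t = b i then \<mu> i *\<^sub>R t else 0))"
        using True by (intro sum.cong) (auto simp: w_def)
      also have "\<dots> = \<mu> i *\<^sub>R (a i - b i)"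
        using that fin[OF that] ab[OF True] by (simp add: sum_subtractf scaleR_diff_right)
      finally show ?thesis
        using True by simp
    qed (simp add: w_def)
    then have "(\<Sum>i\<in>I. \<Sum>t\<in>F i. w i t *\<^sub>R t) = (\<Sum>i\<in>I. if i \<in> J then \<mu> i *\<^sub>R (a i - b i) else 0)"
      by (rule sum.cong[OF refl])
    also have "\<dots> = 0"
      using \<mu>(1) \<open>finite I\<close> \<open>J \<subseteq> I\<close> by (simp add: sum.inter_restrict[symmetric] Int_absorb1)
    finally have w_zero: "(\<Sum>i\<in>I. \<Sum>t\<in>F i. w i t *\<^sub>R t) = 0" .
    \<comment> \<open>\<open>K\<close> collects the weights that decrease along \<open>w\<close>. It
      is nonempty: where \<open>\<mu> i\<close> is nonzero, either \<open>a i\<close> or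
      \<open>b i\<close> loses weight.\<close>
    define K where "K = {p \<in> Sigma I F. w (fst p) (snd p) < 0}"
    have "finite K"
      using \<open>finite I\<close> fin by (auto simp: K_def)
    moreover have "K \<noteq> {}"
    proof -
      obtain i where i: "i \<in> J" "\<mu> i \<noteq> 0"
        using \<mu>(2) by blast
      show ?thesis
      proof (cases "\<mu> i < 0")
        case True
        then have "(i, a i) \<in> K"
          using i ab[of i] \<open>J \<subseteq> I\<close> by (auto simp: K_def w_def)
        then show ?thesis by blast
      next
        case False
        then have "(i, b i) \<in> K"
          using i ab[of i] \<open>J \<subseteq> I\<close> by (auto simp: K_def w_def)
        then show ?thesis by blast
      qed
    qed
    ultimately have "\<exists>p. is_arg_min (\<lambda>p. u (fst p) (snd p) / - w (fst p) (snd p)) (\<lambda>p. p \<in> K) p"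
      by (rule ex_is_arg_min_if_finite)
    then obtain i0 t0 where 0: "(i0, t0) \<in> K"
      and min: "\<And>i t. (i, t) \<in> K \<Longrightarrow> u i0 t0 / - w i0 t0 \<le> u i t / - w i t"
      unfolding is_arg_min_linorder by force
    define s where "s = u i0 t0 / - w i0 t0"
    have i0: "i0 \<in> I" "t0 \<in> F i0" "w i0 t0 < 0"
      using 0 by (auto simp: K_def)
    have "s \<ge> 0"
      using nonneg[OF i0(1,2)] i0(3) by (simp add: s_def divide_nonneg_neg)
    define u' where "u' i t = u i t + s * w i t" for i t
    define F' where "F' = F(i0 := F i0 - {t0})"
    have u'0: "u' i0 t0 = 0"
      using i0(3) by (simp add: u'_def s_def)
    have u'_nonneg: "u' i t \<ge> 0" if "i \<in> I" "t \<in> F i" for i t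
    proof (cases "w i t < 0")
      case True
      then have "s \<le> u i t / - w i t"
        unfolding s_def using that by (intro min) (auto simp: K_def)
      then have "s * - w i t \<le> u i t"
        using True by (subst (asm) pos_le_divide_eq) auto
      then show ?thesis
        by (simp add: u'_def)
    next
      case False
      then show ?thesis
        using nonneg[OF that] \<open>s \<ge> 0\<close> by (simp add: u'_def)
    qed
    have F'_fin: "finite (F' i)" and F'_sub: "F' i \<subseteq> F i" if "i \<in> I" for i
      using fin[OF that] by (auto simp: F'_def)
    have u'_outside: "u' i t = 0" if "t \<in> F i - F' i" for i t
      using that u'0 by (auto simp: F'_def split: if_splits)
    have u'_sum1: "sum (u' i) (F' i) = 1" if "i \<in> I" for i
    proof -
      have "sum (u' i) (F' i) = sum (u' i) (F i)"
        using fin[OF that] F'_sub[OF that] u'_outside by (intro sum.mono_neutral_left) auto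
      also have "\<dots> = 1"
        using sum1[OF that] w_sum[OF that]
        by (simp add: u'_def sum.distrib sum_distrib_left[symmetric])
      finally show ?thesis .
    qed
    have "(\<Sum>i\<in>I. \<Sum>t\<in>F' i. u' i t *\<^sub>R t) = (\<Sum>i\<in>I. \<Sum>t\<in>F i. u' i t *\<^sub>R t)"
      using fin F'_sub u'_outside by (intro sum.cong sum.mono_neutral_left) auto
    also have "\<dots> = (\<Sum>i\<in>I. \<Sum>t\<in>F i. u i t *\<^sub>R t) + s *\<^sub>R (\<Sum>i\<in>I. \<Sum>t\<in>F i. w i t *\<^sub>R t)"
      by (simp add: u'_def scaleR_add_left sum.distrib scaleR_sum_right)
    finally have x: "(\<Sum>i\<in>I. \<Sum>t\<in>F' i. u' i t *\<^sub>R t) = (\<Sum>i\<in>I. \<Sum>t\<in>F i. u i t *\<^sub>R t)"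
      by (simp add: w_zero)
    have "(\<Sum>i\<in>I. card (F' i)) < (\<Sum>i\<in>I. card (F i))"
    proof (rule sum_strict_mono_ex1[OF \<open>finite I\<close>])
      show "\<forall>i\<in>I. card (F' i) \<le> card (F i)"
        using fin F'_sub by (auto intro: card_mono)
      have "card (F' i0) < card (F i0)"
        unfolding F'_def using fin[OF i0(1)] i0(2) by (simp add: card_Diff1_less del: card_Diff_insert)
      then show "\<exists>i\<in>I. card (F' i) < card (F i)"
        using i0(1) by blast
    qed
    from less.hyps[OF this F'_fin _ u'_sum1] u'_nonneg F'_sub
    obtain z where z: "\<forall>i\<in>I. z i \<in> convex hull F' i"
      "sum z I = (\<Sum>i\<in>I. \<Sum>t\<in>F' i. u' i t *\<^sub>R t)" "card {i\<in>I. z i \<notin> F' i} \<le> DIM('a)"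
      by blast
    \<comment> \<open>Since \<open>F' i\<close> lies in \<open>F i\<close>, enlarging the supports
      back can only remove exceptional indices.\<close>
    have "card {i\<in>I. z i \<notin> F i} \<le> card {i\<in>I. z i \<notin> F' i}"
      using F'_sub \<open>finite I\<close> by (intro card_mono) auto
    moreover have "z i \<in> convex hull F i" if "i \<in> I" for i
      using z(1) hull_mono[OF F'_sub[OF that]] that by blast
    ultimately show ?thesis
      using z x by (intro exI[of _ z]) auto
  qed
qed

text \<open>Each \<open>y i\<close> is a convex combination of a finite subset \<open>F i\<close> of
  \<open>T i\<close>. The weighted form applies to these subsets, and a point outside
  \<open>T i\<close> is also outside \<open>F i\<close>, so the count carries over.\<close>

lemma shapley_folkman:
  fixes T :: "'i \<Rightarrow> 'a::euclidean_space set"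
  assumes "finite I" and "\<And>i. i \<in> I \<Longrightarrow> y i \<in> convex hull T i"
  obtains z where "\<And>i. i \<in> I \<Longrightarrow> z i \<in> convex hull T i" and "sum z I = sum y I"
    and "card {i\<in>I. z i \<notin> T i} \<le> DIM('a)"
proof -
  have "\<forall>i\<in>I. \<exists>F u. finite F \<and> F \<subseteq> T i \<and> (\<forall>t\<in>F. 0 \<le> u t) \<and> sum u F = 1
      \<and> (\<Sum>t\<in>F. u t *\<^sub>R t) = y i"
    using assms(2) unfolding convex_hull_explicit by blast
  then obtain F u where F: "\<And>i. i \<in> I \<Longrightarrow> finite (F i) \<and> F i \<subseteq> T i \<and> (\<forall>t\<in>F i. 0 \<le> u i t)
      \<and> sum (u i) (F i) = 1 \<and> (\<Sum>t\<in>F i. u i t *\<^sub>R t) = y i"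
    unfolding bchoice_iff by blast
  then obtain z where z: "\<forall>i\<in>I. z i \<in> convex hull F i"
      "sum z I = (\<Sum>i\<in>I. \<Sum>t\<in>F i. u i t *\<^sub>R t)" "card {i\<in>I. z i \<notin> F i} \<le> DIM('a)"
    using shapley_folkman_weights[OF \<open>finite I\<close>, of F u] by blast
  show thesis
  proof
    show "z i \<in> convex hull T i" if "i \<in> I" for i
      using z(1) F[OF that] that hull_mono by blast
    show "sum z I = sum y I"
      using z(2) F by simp
    have "card {i\<in>I. z i \<notin> T i} \<le> card {i\<in>I. z i \<notin> F i}"
      using F \<open>finite I\<close> by (intro card_mono) auto
    then show "card {i\<in>I. z i \<notin> T i} \<le> DIM('a)"
      using z(3) by simp
  qed
qed

section \<open>Rounding the summands and Starr's bound\<close>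

text \<open>
  If every \<open>z \<in> T\<close> failed, then \<open>(v + y - c) \<bullet> z < (v + y - c) \<bullet> y\<close> would hold on \<open>T\<close> and therefore
  at \<open>y\<close>.
\<close>

lemma rounding_step:
  fixes v y c :: "'a::real_inner"
  assumes y: "y \<in> convex hull T" and T: "T \<subseteq> cball c r"
  obtains z where "z \<in> T" and "(norm (v + (y - z)))\<^sup>2 \<le> (norm v)\<^sup>2 + r\<^sup>2"
proof -
  have "\<exists>z\<in>T. (norm (v + (y - z)))\<^sup>2 \<le> (norm v)\<^sup>2 + r\<^sup>2"
  proof (rule ccontr)
    assume "\<not> ?thesis"
    then have less: "(norm v)\<^sup>2 + r\<^sup>2 < (norm (v + (y - z)))\<^sup>2" if "z \<in> T" for z
      using that by force
    have "T \<subseteq> {z. (v + y - c) \<bullet> z < (v + y - c) \<bullet> y}"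
    proof safe
      fix z assume "z \<in> T"
      then have "(norm (c - z))\<^sup>2 \<le> r\<^sup>2"
        using T by (intro power_mono) (auto simp: dist_norm)
      \<comment> \<open>Expand the square of \<open>(v + y - c) + (c - z)\<close>, then complete the
        square using \<open>v = (v + y - c) - (y - c)\<close>.\<close>
      moreover have "(norm (v + (y - z)))\<^sup>2 = (norm v)\<^sup>2 + (norm (c - z))\<^sup>2
          + 2 * ((v + y - c) \<bullet> y - (v + y - c) \<bullet> z) - (norm (y - c))\<^sup>2"
        by (simp add: power2_norm_eq_inner inner_simps inner_commute)
      ultimately show "(v + y - c) \<bullet> z < (v + y - c) \<bullet> y"
        using less[OF \<open>z \<in> T\<close>] zero_le_power2[of "norm (y - c)"] by (smt (verit))
    qed
    then have "convex hull T \<subseteq> {z. (v + y - c) \<bullet> z < (v + y - c) \<bullet> y}"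
      by (rule hull_minimal) (rule convex_halfspace_lt)
    then show False
      using y by auto
  qed
  then show thesis
    using that by blast
qed

text \<open>The error accumulated so far plays the role of \<open>v\<close> in
  \<open>rounding_step\<close>, so the squared radii add up instead of the radii.\<close>

lemma rounding_sum:
  fixes y :: "'i \<Rightarrow> 'a::real_inner"
  assumes "finite I" and "\<And>i. i \<in> I \<Longrightarrow> y i \<in> convex hull T i"
    and "\<And>i. i \<in> I \<Longrightarrow> T i \<subseteq> cball (c i) (r i)"
  shows "\<exists>z. (\<forall>i\<in>I. z i \<in> T i) \<and> (norm (\<Sum>i\<in>I. y i - z i))\<^sup>2 \<le> (\<Sum>i\<in>I. (r i)\<^sup>2)"
  using assms
proof (induction I rule: finite_induct)
  case empty
  then show ?case by simp
next
  case (insert j I)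
  then obtain z where z: "\<forall>i\<in>I. z i \<in> T i" "(norm (\<Sum>i\<in>I. y i - z i))\<^sup>2 \<le> (\<Sum>i\<in>I. (r i)\<^sup>2)"
    by auto
  obtain t where t: "t \<in> T j"
    "(norm ((\<Sum>i\<in>I. y i - z i) + (y j - t)))\<^sup>2 \<le> (norm (\<Sum>i\<in>I. y i - z i))\<^sup>2 + (r j)\<^sup>2"
    using rounding_step insert.prems by (metis insertI1)
  have "(\<Sum>i\<in>I. y i - (z(j := t)) i) = (\<Sum>i\<in>I. y i - z i)"
    using insert.hyps by (intro sum.cong) auto
  then have "(\<Sum>i\<in>insert j I. y i - (z(j := t)) i) = (\<Sum>i\<in>I. y i - z i) + (y j - t)"
    using insert.hyps by (simp add: add.commute)
  then have "(norm (\<Sum>i\<in>insert j I. y i - (z(j := t)) i))\<^sup>2 \<le> (\<Sum>i\<in>insert j I. (r i)\<^sup>2)"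
    using t(2) z(2) insert.hyps by (simp add: add.commute)
  then show ?case
    using z(1) t(1) by (intro exI[of _ "z(j := t)"]) auto
qed

lemma shapley_folkman_starr:
  fixes T :: "'i \<Rightarrow> 'a::euclidean_space set"
  assumes "finite I" and "\<And>i. i \<in> I \<Longrightarrow> y i \<in> convex hull T i"
    and "\<And>i. i \<in> I \<Longrightarrow> T i \<subseteq> cball (c i) r"
  obtains z where "\<And>i. i \<in> I \<Longrightarrow> z i \<in> T i"
    and "(norm (sum y I - sum z I))\<^sup>2 \<le> real (min DIM('a) (card I)) * r\<^sup>2"
proof -
  obtain x where x: "\<And>i. i \<in> I \<Longrightarrow> x i \<in> convex hull T i" "sum x I = sum y I"
    "card {i\<in>I. x i \<notin> T i} \<le> DIM('a)"
    using shapley_folkman[where T = T, OF assms(1,2)] by blast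
  define K where "K = {i\<in>I. x i \<notin> T i}"
  have K: "finite K" "K \<subseteq> I" "card K \<le> min DIM('a) (card I)"
    using x(3) \<open>finite I\<close> by (auto simp: K_def intro: card_mono)
  have "\<exists>z. (\<forall>i\<in>K. z i \<in> T i) \<and> (norm (\<Sum>i\<in>K. x i - z i))\<^sup>2 \<le> (\<Sum>i\<in>K. r\<^sup>2)"
    by (rule rounding_sum[where c = c]) (use K x(1) assms(3) in auto)
  then obtain z where z: "\<forall>i\<in>K. z i \<in> T i" "(norm (\<Sum>i\<in>K. x i - z i))\<^sup>2 \<le> real (card K) * r\<^sup>2"
    by auto
  \<comment> \<open>Outside \<open>K\<close> the point \<open>x i\<close> already belongs to
    \<open>T i\<close> and is kept, so only indices in \<open>K\<close> contribute to the
    error.\<close>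
  define z' where "z' i = (if i \<in> K then z i else x i)" for i
  show thesis
  proof
    show "z' i \<in> T i" if "i \<in> I" for i
      using that z(1) by (auto simp: z'_def K_def)
    have "sum y I - sum z' I = (\<Sum>i\<in>I. x i - z' i)"
      by (simp add: x(2) sum_subtractf)
    also have "\<dots> = (\<Sum>i\<in>K. x i - z i)"
      using K \<open>finite I\<close> by (intro sum.mono_neutral_cong_right) (auto simp: z'_def)
    finally have "(norm (sum y I - sum z' I))\<^sup>2 \<le> real (card K) * r\<^sup>2"
      using z(2) by simp
    also have "\<dots> \<le> real (min DIM('a) (card I)) * r\<^sup>2"
      using K(3) by (intro mult_right_mono) auto
    finally show "(norm (sum y I - sum z' I))\<^sup>2 \<le> real (min DIM('a) (card I)) * r\<^sup>2" .
  qed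
qed

section \<open>Integral neighborhoods and integrality of the error\<close>

text \<open>The centre is the midpoint of the unit cube with lower corner
  \<open>\<lfloor>x $ j\<rfloor>\<close>, and the radius is half the diagonal. An integer at
  distance less than 1 from \<open>x $ j\<close> is the floor or its successor, hence a coordinate
  of a cube vertex.\<close>

lemma integral_neighborhood_subset_cball:
  fixes x :: "real ^ 'n"
  shows "integral_neighborhood x \<subseteq> cball (\<chi> j. of_int \<lfloor>x $ j\<rfloor> + 1 / 2) (sqrt (real CARD('n)) / 2)"
proof
  fix z assume z: "z \<in> integral_neighborhood x"
  define c :: "real ^ 'n" where "c = (\<chi> j. of_int \<lfloor>x $ j\<rfloor> + 1 / 2)"
  have "\<bar>(c - z) $ j\<bar> \<le> 1/2" for j
  proof -
    obtain k where k: "z $ j = of_int k"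
      using z unfolding integral_neighborhood_def integer_points_def by (blast elim: Ints_cases)
    have "\<bar>x $ j - of_int k\<bar> < 1"
      using z k by (auto simp: integral_neighborhood_def dest: spec[of _ j])
    then have "k = \<lfloor>x $ j\<rfloor> \<or> k = \<lfloor>x $ j\<rfloor> + 1"
      by linarith
    then show ?thesis
      by (auto simp: c_def k)
  qed
  then have "((c - z) $ j)\<^sup>2 \<le> (1/2)\<^sup>2" for j
    by (simp only: abs_le_square_iff[symmetric]) simp
  then have "(\<Sum>j\<in>UNIV. ((c - z) $ j)\<^sup>2) \<le> (\<Sum>j\<in>(UNIV :: 'n set). (1/2)\<^sup>2)"
    by (rule sum_mono)
  then have "norm (c - z) \<le> sqrt (real CARD('n) / 4)"
    by (simp add: norm_vec_def L2_set_def power2_eq_square)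
  then show "z \<in> cball (\<chi> j. of_int \<lfloor>x $ j\<rfloor> + 1 / 2) (sqrt (real CARD('n)) / 2)"
    by (simp add: dist_norm c_def real_sqrt_divide)
qed

text \<open>The norm is a maximum over finitely many coordinates, so it is attained at one of
  them.\<close>

lemma infnorm_in_Ints:
  fixes x :: "real ^ 'n"
  assumes "\<And>j. x $ j \<in> \<int>"
  shows "infnorm x \<in> \<int>"
proof -
  have "infnorm x \<in> (\<lambda>i. \<bar>x \<bullet> i\<bar>) ` Basis"
    unfolding infnorm_Max by (rule Max_in) auto
  then show ?thesis
    using assms by (auto simp: Basis_vec_def inner_axis)
qed

lemma integer_points_sum:
  assumes "\<And>i. i \<in> I \<Longrightarrow> z i \<in> integer_points"
  shows "sum z I \<in> integer_points"
  using assms by (auto simp: integer_points_def intro: Ints_sum)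

section \<open>Proximity for sums of integrally convex sets\<close>

theorem theorem3p2:
  fixes S :: "nat \<Rightarrow> (real ^ 'n) set" and W :: "(real ^ 'n) set" and m :: nat
  assumes "m \<ge> 1"
    and "\<And>i. i \<in> {1..m} \<Longrightarrow> integrally_convex (S i)"
    and "W = (\<Sum>i = 1..m. S i)"
  shows "(\<forall>x \<in> convex hull W. \<exists>z \<in> W.
            norm (x - z) \<le> sf_bound CARD('n) m \<and>
            infnorm (x - z) \<le> sf_bound CARD('n) m) \<and>
         (\<forall>x \<in> convex hull W \<inter> integer_points. \<exists>z \<in> W.
            norm (x - z) \<le> sf_bound CARD('n) m \<and>
            infnorm (x - z) \<le> of_int \<lfloor>sf_bound CARD('n) m\<rfloor>)"
proof -
  have W: "W = {sum s {1..m} |s. \<forall>i\<in>{1..m}. s i \<in> S i}"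
    unfolding assms(3) by (rule set_sum_alt) simp
  have near: "\<exists>z\<in>W. norm (x - z) \<le> sf_bound CARD('n) m" if "x \<in> convex hull W" for x
  proof -
    \<comment> \<open>Convex hulls commute with Minkowski sums.\<close>
    have "x \<in> (\<Sum>i = 1..m. convex hull S i)"
      using that unfolding assms(3) by (simp add: convex_hull_set_sum)
    then obtain y where y: "x = sum y {1..m}" "\<And>i. i \<in> {1..m} \<Longrightarrow> y i \<in> convex hull S i"
      by (auto simp: set_sum_alt)
    define T where "T i = S i \<inter> integral_neighborhood (y i)" for i
    have y_T: "y i \<in> convex hull T i" if "i \<in> {1..m}" for i
      using assms(2)[OF that] y(2)[OF that] by (simp add: integrally_convex_def T_def)
    have T_cball: "T i \<subseteq> cball (\<chi> j. of_int \<lfloor>y i $ j\<rfloor> + 1 / 2) (sqrt (real CARD('n)) / 2)" for i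
      using integral_neighborhood_subset_cball by (auto simp: T_def)
    obtain z where z: "\<And>i. i \<in> {1..m} \<Longrightarrow> z i \<in> T i"
      "(norm (sum y {1..m} - sum z {1..m}))\<^sup>2
        \<le> real (min DIM(real ^ 'n) (card {1..m})) * (sqrt (real CARD('n)) / 2)\<^sup>2"
      by (rule shapley_folkman_starr[where I = "{1..m}" and T = T, OF _ y_T T_cball]) auto
    \<comment> \<open>With squared radius \<open>n / 4\<close> for dimension \<open>n\<close>, the
      bound \<open>min n m * (n / 4)\<close> is the square of \<open>sf_bound n m\<close>.\<close>
    have "(norm (x - sum z {1..m}))\<^sup>2 \<le> (sf_bound CARD('n) m)\<^sup>2"
      using z(2) by (simp add: y(1) sf_bound_def power_divide power_mult_distrib mult.commute)
    then have "norm (x - sum z {1..m}) \<le> sf_bound CARD('n) m"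
      by (rule power2_le_imp_le) (simp add: sf_bound_def)
    moreover have "sum z {1..m} \<in> W"
      unfolding W using z(1) by (auto simp: T_def)
    ultimately show ?thesis by blast
  qed
  have W_int: "W \<subseteq> integer_points"
    unfolding W using assms(2) by (fastforce simp: integrally_convex_def intro: integer_points_sum)
  show ?thesis
  proof (intro conjI ballI)
    fix x assume "x \<in> convex hull W"
    then show "\<exists>z\<in>W. norm (x - z) \<le> sf_bound CARD('n) m \<and> infnorm (x - z) \<le> sf_bound CARD('n) m"
      using near infnorm_le_norm order_trans by blast
  next
    fix x assume x: "x \<in> convex hull W \<inter> integer_points"
    then obtain z where z: "z \<in> W" "norm (x - z) \<le> sf_bound CARD('n) m"
      using near by blast
    \<comment> \<open>Both points are integral here, so the maximum norm of their difference is an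
      integer, and an integer below the bound is below its floor.\<close>
    have "infnorm (x - z) \<in> \<int>"
      by (rule infnorm_in_Ints) (use x z(1) W_int in \<open>auto simp: integer_points_def\<close>)
    then obtain k where k: "infnorm (x - z) = of_int k"
      by (elim Ints_cases)
    moreover have "of_int k \<le> sf_bound CARD('n) m"
      using infnorm_le_norm[of "x - z"] z(2) k by linarith
    ultimately show "\<exists>z\<in>W. norm (x - z) \<le> sf_bound CARD('n) m
        \<and> infnorm (x - z) \<le> of_int \<lfloor>sf_bound CARD('n) m\<rfloor>"
      using z by (intro bexI[of _ z]) (auto simp: le_floor_iff)
  qed
qed

end
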